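(* Let $n\ge 2$ and let $E_1|H_1,\ldots,E_n|H_n$ be conditional events with $E_1,H_1,\ldots,E_n,H_n$ logically independent. Let $\mathcal{M}=(x_S:\emptyset\neq S\subseteq\{1,\ldots,n\})$ be a coherent prevision assessment on the family $\mathscr{F}=\{\mathscr{C}_S:\emptyset\neq S\subseteq\{1,\ldots,n\}\}$, where $\mathscr{C}_S=\bigwedge_{i\in S}(E_i|H_i)$ and $x_S=\mathbb{P}(\mathscr{C}_S)$. Then, for every $1\le k\le n-1$, \[ \max\{0,\;x_{1\cdots k}+x_{k+1\cdots n}-1\}\;\le\; x_{1\cdots n}\;\le\;\min\{x_{1\cdots k},\,x_{k+1\cdots n}\}, \] where $x_{1\cdots k}=\mathbb{P}(\mathscr{C}_{\{1,\ldots,k\}})$, $x_{k+1\cdots n}=\mathbb{P}(\mathscr{C}_{\{k+1,\ldots,n\}})$ and $x_{1\cdots n}=\mathbb{P}(\mathscr{C}_{\{1,\ldots,n\}})$.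
   Context: Events. Events are elements of a Boolean algebra with top $\Omega$ (sure event) and bottom $\emptyset$ (impossible event); one may take subsets of a set $\Omega$. An event is identified with its $0/1$ indicator; $EF$ or $E\wedge F$ is conjunction, $E\vee F$ disjunction, $\overline{E}$ negation, and $E\subseteq F$ means $E\overline{F}=\emptyset$. Events $A_1,\ldots,A_m$ are logically independent if all $2^m$ conjunctions $A_1^*\cdots A_m^*$ with $A_i^*\in\{A_i,\overline{A}_i\}$ are $\neq\emptyset$. Conditional random quantities. Given an event $H\neq\emptyset$, a random quantity $X$ (a real-valued function on $\Omega$ with finitely many values on $H$) and an assessed real number $\mu=\mathbb{P}(X|H)$ (the conditional prevision), the conditional random quantity $X|H$ is $XH+\mu\overline{H}$ (value $X$ if $H$ is true, $\mu$ if $H$ is false). For a conditional event $E|H$ with $P(E|H)=x$, its indicator (same symbol) is $E|H=EH+x\overline{H}$; it is called true, false or void when $EH$, $\overline{E}H$ or $\overline{H}$ is true, respectively. Coherence. A prevision assessment on a family of conditional random quantities is coherent if for every finite subfamily $X_1|H_1,\ldots,X_m|H_m$ with assessed previsions $\mu_1,\ldots,\mu_m$ and all real $s_1,\ldots,s_m$, the random gain $G=\sum_{i=1}^m s_iH_i(X_i-\mu_i)$, restricted to $H_1\vee\cdots\vee H_m$, satisfies $\min G\le 0\le\max G$. Conjunction. For a finite family $(A_i|K_i)_{i\in T}$ of conditional events, the conjunctions $\mathscr{C}_S=\bigwedge_{i\in S}(A_i|K_i)$, $\emptyset\ne S\subseteq T$, with assessed previsions $x_S=\mathbb{P}(\mathscr{C}_S)$,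 are defined recursively on $|S|$ by \[ \mathscr{C}_S=\Big[\bigwedge_{i\in S}A_iK_i+\sum_{\emptyset\neq R\subsetneq S}x_R\Big(\bigwedge_{i\in R}\overline{K}_i\Big)\wedge\Big(\bigwedge_{i\in S\setminus R}A_iK_i\Big)\Big]\Big|\Big(\bigvee_{i\in S}K_i\Big), \] i.e. $\mathscr{C}_S$ has value $1$ if all $A_iK_i$ ($i\in S$) are true; $0$ if some $\overline{A}_iK_i$ is true; $x_R$ if exactly the conditional events with index in $R$ are void and the others are true ($\emptyset\ne R\subsetneq S$); $x_S$ if all $K_i$, $i\in S$, are false. For $S=\{i\}$, $\mathscr{C}_S=A_i|K_i$. *)

theory Defs
  imports Complex_Main "HOL-Library.Indicator_Function"
begin

text \<open>
  Events are subsets of the sure event \<^term>\<open>UNIV :: 'w set\<close>.  A conditional random quantity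
  \<open>X | H\<close> is the pair \<open>(X, H)\<close>; its prevision \<open>\<mu>\<close> is supplied separately by an assessment.
\<close>

type_synonym 'w cond_rq = "('w \<Rightarrow> real) \<times> 'w set"

definition logically_independent :: "'i set \<Rightarrow> ('i \<Rightarrow> 'w set) \<Rightarrow> bool" where
  "logically_independent I A \<longleftrightarrow>
     (\<forall>J \<subseteq> I. (\<Inter>i\<in>J. A i) \<inter> (\<Inter>i\<in>I - J. - A i) \<noteq> {})"

definition gain :: "'i set \<Rightarrow> ('i \<Rightarrow> 'w cond_rq) \<Rightarrow> ('i \<Rightarrow> real) \<Rightarrow> ('i \<Rightarrow> real) \<Rightarrow> 'w \<Rightarrow> real" where
  "gain J F \<mu> s \<omega> = (\<Sum>i\<in>J. s i * indicator (snd (F i)) \<omega> * (fst (F i) \<omega> - \<mu> i))"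

text \<open>
  The family \<open>F\<close> is indexed by \<open>I\<close>.  Conditional random quantities take finitely many values on
  their (nonempty) conditioning events, so \<^const>\<open>Min\<close> and \<^const>\<open>Max\<close> range over finite
  nonempty sets.
\<close>

definition coherent_prevision :: "'i set \<Rightarrow> ('i \<Rightarrow> 'w cond_rq) \<Rightarrow> ('i \<Rightarrow> real) \<Rightarrow> bool" where
  "coherent_prevision I F \<mu> \<longleftrightarrow>
     (\<forall>J s. finite J \<and> J \<noteq> {} \<and> J \<subseteq> I \<longrightarrow>
        Min (gain J F \<mu> s ` (\<Union>i\<in>J. snd (F i))) \<le> 0 \<and>
        0 \<le> Max (gain J F \<mu> s ` (\<Union>i\<in>J. snd (F i))))"

text \<open>
  The conjunction of the conditional events \<open>A i | K i\<close>, \<open>i \<in> S\<close>.  The recursion on the size of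
  \<open>S\<close> enters only through the previsions \<open>x R\<close> of the smaller conjunctions, which are given
  here by the assessment \<open>x\<close>.
\<close>

definition conj_cond ::
  "('i \<Rightarrow> 'w set) \<Rightarrow> ('i \<Rightarrow> 'w set) \<Rightarrow> ('i set \<Rightarrow> real) \<Rightarrow> 'i set \<Rightarrow> 'w cond_rq" where
  "conj_cond A K x S =
     ((\<lambda>\<omega>. indicator (\<Inter>i\<in>S. A i \<inter> K i) \<omega> +
        (\<Sum>R | R \<noteq> {} \<and> R \<subset> S.
           x R * indicator ((\<Inter>i\<in>R. - K i) \<inter> (\<Inter>i\<in>S - R. A i \<inter> K i)) \<omega>)),
      \<Union>i\<in>S. K i)"

lemma finite_range_conj_cond:
  assumes "finite S"
  shows "finite (range (fst (conj_cond A K x S)))"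
proof -
  let ?P = "{R. R \<noteq> {} \<and> R \<subset> S}"
  let ?B = "\<lambda>R. (\<Inter>i\<in>R. - K i) \<inter> (\<Inter>i\<in>S - R. A i \<inter> K i)"
  let ?C = "\<Inter>i\<in>S. A i \<inter> K i"
  let ?h = "\<lambda>(b, Q). of_bool b + (\<Sum>R\<in>?P. x R * of_bool (R \<in> Q))"
  have fin: "finite ?P"
    by (rule finite_subset[of _ "Pow S"]) (use assms in auto)
  have "fst (conj_cond A K x S) \<omega> = ?h (\<omega> \<in> ?C, {R \<in> ?P. \<omega> \<in> ?B R})" for \<omega>
    unfolding conj_cond_def fst_conv prod.case indicator_def
    by (intro arg_cong2[where f = "(+)"] sum.cong refl) simp_all
  then have "range (fst (conj_cond A K x S)) \<subseteq> ?h ` (UNIV \<times> Pow ?P)"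
    by blast
  moreover have "finite (UNIV \<times> Pow ?P :: (bool \<times> _) set)"
    using fin by (intro finite_cartesian_product) simp_all
  ultimately show ?thesis
    by (rule finite_subset[OF _ finite_imageI])
qed

end

theory Submission
  imports Defs
begin

text \<open>
  Put \<open>x {} = 1\<close>.  If \<open>V\<close> is the set of the void conditional events of an outcome, then
  the conjunction over \<open>S\<close> takes the value \<open>0\<close> when some member of \<open>S\<close> is false, and \<open>x (V \<inter> S)\<close>
  otherwise; this includes the case \<open>S \<subseteq> V\<close>, where the conjunction is void.  So on the outcomes
  that matter for the family of all \<open>R \<subseteq> S\<close>, where \<open>V \<inter> S\<close> is a proper subset of \<open>S\<close>, the values
  of the conjunctions are themselves previsions of conjunctions over smaller index sets.

  Coherence says that a linear inequality satisfied by the values of the conjunctions on all those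
  outcomes is also satisfied by their previsions (\<open>prevision_ge_of_value_ge\<close>): otherwise the
  corresponding bet would have a gain bounded away from zero.  Together the two observations give
  proofs by induction on the index set: an inequality between previsions for the proper subsets of
  \<open>S\<close> is an inequality between values for \<open>S\<close>, and hence an inequality between previsions for \<open>S\<close>.
  Nonnegativity, monotonicity and the lower Frechet bound \<open>x A + x B - 1 \<le> x (A \<union> B)\<close> are all
  obtained in this way.  Taking \<open>A = {1..k}\<close> and \<open>B = {k+1..n}\<close> yields the claim.
\<close>

section \<open>Coherence as the absence of a sure gain\<close>

lemma finite_range_sum:
  fixes f :: "'i \<Rightarrow> 'w \<Rightarrow> 'b::comm_monoid_add"
  assumes "finite J" and "\<And>i. i \<in> J \<Longrightarrow> finite (range (f i))"
  shows "finite (range (\<lambda>\<omega>. \<Sum>i\<in>J. f i \<omega>))"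
  using assms
proof (induction J rule: finite_induct)
  case empty
  then show ?case by simp
next
  case (insert j J)
  have "range (\<lambda>\<omega>. \<Sum>i\<in>insert j J. f i \<omega>)
      \<subseteq> (\<lambda>(a, b). a + b) ` (range (f j) \<times> range (\<lambda>\<omega>. \<Sum>i\<in>J. f i \<omega>))"
    using insert.hyps by auto
  then show ?case
    by (rule finite_subset) (use insert in auto)
qed

lemma finite_range_gain:
  assumes "finite J" and "\<And>i. i \<in> J \<Longrightarrow> finite (range (fst (F i)))"
  shows "finite (range (gain J F \<mu> s))"
proof -
  have "finite (range (\<lambda>\<omega>. s i * indicator (snd (F i)) \<omega> * (fst (F i) \<omega> - \<mu> i)))"
    if "i \<in> J" for i
  proof (rule finite_subset)
    show "range (\<lambda>\<omega>. s i * indicator (snd (F i)) \<omega> * (fst (F i) \<omega> - \<mu> i))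
        \<subseteq> (\<lambda>(a, b). s i * a * (b - \<mu> i)) ` ({0, 1} \<times> range (fst (F i)))"
      by (force simp: indicator_def)
    show "finite ((\<lambda>(a, b). s i * a * (b - \<mu> i)) ` ({0, 1} \<times> range (fst (F i))))"
      using assms(2)[OF that] by simp
  qed
  then show ?thesis
    unfolding gain_def using assms(1) by (intro finite_range_sum)
qed

lemma coherent_prevision_gain_le_0:
  assumes "coherent_prevision I F \<mu>" and "finite J" "J \<noteq> {}" "J \<subseteq> I"
    and "\<And>i. i \<in> J \<Longrightarrow> finite (range (fst (F i)))"
    and "(\<Union>i\<in>J. snd (F i)) \<noteq> {}"
  obtains \<omega> where "\<omega> \<in> (\<Union>i\<in>J. snd (F i))" "gain J F \<mu> s \<omega> \<le> 0"
proof -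
  let ?G = "gain J F \<mu> s ` (\<Union>i\<in>J. snd (F i))"
  have "finite ?G"
    by (rule finite_subset[OF _ finite_range_gain[of J F \<mu> s]]) (use assms in auto)
  then have "Min ?G \<in> ?G"
    using assms(6) by (intro Min_in) auto
  moreover have "Min ?G \<le> 0"
    using assms(1-4) unfolding coherent_prevision_def by blast
  ultimately show ?thesis
    using that by fastforce
qed

section \<open>The values of a conjunction\<close>

text \<open>
  The empty conjunction is the sure event.  Giving it prevision \<open>1\<close> lets \<open>x\<close> of the set of void
  members cover the case in which no member is void.
\<close>

definition prev1 :: "('i set \<Rightarrow> real) \<Rightarrow> 'i set \<Rightarrow> real" where
  "prev1 x R = (if R = {} then 1 else x R)"

text \<open>
  Unlike the first component of \<^const>\<open>conj_cond\<close>, this function is the conditional random quantity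
  on the whole space: it equals the prevision where the conjunction is void.
\<close>

definition conj_value ::
  "('i \<Rightarrow> 'w set) \<Rightarrow> ('i \<Rightarrow> 'w set) \<Rightarrow> ('i set \<Rightarrow> real) \<Rightarrow> 'i set \<Rightarrow> 'w \<Rightarrow> real" where
  "conj_value A K x S \<omega> =
     (if \<exists>i\<in>S. \<omega> \<in> K i - A i then 0 else prev1 x {i \<in> S. \<omega> \<notin> K i})"

lemma conj_value_empty [simp]: "conj_value A K x {} \<omega> = 1"
  by (simp add: conj_value_def prev1_def)

text \<open>
  At most one summand in the definition of \<^const>\<open>conj_cond\<close> is nonzero at a given outcome, namely
  the one for the set of void members.
\<close>

lemma fst_conj_cond_eq_conj_value:
  assumes "finite S" and "\<omega> \<in> (\<Union>i\<in>S. K i)"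
  shows "fst (conj_cond A K x S) \<omega> = conj_value A K x S \<omega>"
proof -
  let ?P = "{R. R \<noteq> {} \<and> R \<subset> S}"
  define V where "V = {i \<in> S. \<omega> \<notin> K i}"
  define c :: real where "c = of_bool (\<not> (\<exists>i\<in>S. \<omega> \<in> K i - A i))"
  have fin: "finite ?P"
    by (rule finite_subset[of _ "Pow S"]) (use assms in auto)
  have V: "V \<subset> S"
    using assms(2) by (auto simp: V_def)
  have first: "indicator (\<Inter>i\<in>S. A i \<inter> K i) \<omega> = (if V = {} then c else 0)"
    by (auto simp: indicator_def V_def c_def)
  have "indicator ((\<Inter>i\<in>R. - K i) \<inter> (\<Inter>i\<in>S - R. A i \<inter> K i)) \<omega> = (if R = V then c else 0)"
    if "R \<in> ?P" for R
  proof -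
    have "\<omega> \<in> (\<Inter>i\<in>R. - K i) \<inter> (\<Inter>i\<in>S - R. A i \<inter> K i)
        \<longleftrightarrow> R = V \<and> \<not> (\<exists>i\<in>S. \<omega> \<in> K i - A i)"
      using that by (auto simp: V_def)
    then show ?thesis
      by (simp add: indicator_def c_def)
  qed
  then have "fst (conj_cond A K x S) \<omega>
      = (if V = {} then c else 0) + (\<Sum>R\<in>?P. if R = V then x R * c else 0)"
    unfolding conj_cond_def fst_conv first
    by (intro arg_cong2[where f = "(+)"] sum.cong refl) auto
  also have "\<dots> = c * prev1 x V"
    using fin V by (simp add: prev1_def)
  finally show ?thesis
    by (simp add: conj_value_def c_def V_def)
qed

lemma conj_cond_gain_summand:
  assumes "finite S" "S \<noteq> {}"
  shows "indicator (snd (conj_cond A K x S)) \<omega> * (fst (conj_cond A K x S) \<omega> - x S)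
    = conj_value A K x S \<omega> - prev1 x S"
proof (cases "\<omega> \<in> (\<Union>i\<in>S. K i)")
  case True
  then have "indicator (snd (conj_cond A K x S)) \<omega> = (1::real)"
    by (simp add: conj_cond_def)
  then show ?thesis
    using fst_conj_cond_eq_conj_value[OF assms(1) True] assms(2) by (simp add: prev1_def)
next
  case False
  then have "{i \<in> S. \<omega> \<notin> K i} = S"
    by auto
  then show ?thesis
    using False by (auto simp: conj_cond_def conj_value_def)
qed

section \<open>Inequalities between the previsions of conjunctions\<close>

lemma sum_of_bool_eq_mult:
  fixes f :: "'a \<Rightarrow> real"
  assumes "finite A" "a \<in> A"
  shows "(\<Sum>b\<in>A. of_bool (b = a) * f b) = f a"
proof -
  have "(\<Sum>b\<in>A. of_bool (b = a) * f b) = (\<Sum>b\<in>A. if b = a then f b else 0)"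
    by (rule sum.cong) auto
  then show ?thesis
    using assms by simp
qed

locale coherent_conjunctions =
  fixes N :: "'i set" and E H :: "'i \<Rightarrow> 'w set" and x :: "'i set \<Rightarrow> real"
  assumes finite_index: "finite N"
    and conditioning_nonempty: "i \<in> N \<Longrightarrow> H i \<noteq> {}"
    and coherent: "coherent_prevision {S. S \<noteq> {} \<and> S \<subseteq> N} (conj_cond E H x) x"
begin

abbreviation val :: "'i set \<Rightarrow> 'w \<Rightarrow> real" where
  "val \<equiv> conj_value E H x"

abbreviation prev :: "'i set \<Rightarrow> real" where
  "prev \<equiv> prev1 x"

text \<open>
  The gain of the bet with stakes \<open>s\<close> is the difference between the linear combination of the values
  and that of the previsions.  If the latter were below a lower bound \<open>c\<close> of the former, the gain
  would be positive whenever the bet is in force.  The empty conjunction may enter the combination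
  because it contributes nothing to the gain.
\<close>

lemma prevision_ge_of_value_ge:
  assumes S: "S \<noteq> {}" "S \<subseteq> N"
    and le: "\<And>\<omega>. \<omega> \<in> (\<Union>i\<in>S. H i) \<Longrightarrow> c \<le> (\<Sum>R\<in>Pow S. s R * val R \<omega>)"
  shows "c \<le> (\<Sum>R\<in>Pow S. s R * prev R)"
proof -
  let ?J = "Pow S - {{}}"
  have finS: "finite S"
    using S finite_index finite_subset by blast
  have U: "(\<Union>R\<in>?J. snd (conj_cond E H x R)) = (\<Union>i\<in>S. H i)"
    by (force simp: conj_cond_def)
  have gain: "gain ?J (conj_cond E H x) x s \<omega> =
      (\<Sum>R\<in>Pow S. s R * val R \<omega>) - (\<Sum>R\<in>Pow S. s R * prev R)" for \<omega>
  proof -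
    have "gain ?J (conj_cond E H x) x s \<omega> = (\<Sum>R\<in>?J. s R * (val R \<omega> - prev R))"
      unfolding gain_def
    proof (rule sum.cong[OF refl])
      fix R
      assume "R \<in> ?J"
      then have "finite R" "R \<noteq> {}"
        using finS finite_subset by auto
      then show "s R * indicator (snd (conj_cond E H x R)) \<omega> * (fst (conj_cond E H x R) \<omega> - x R)
          = s R * (val R \<omega> - prev R)"
        using conj_cond_gain_summand[of R E H x \<omega>] by (simp add: mult.assoc)
    qed
    also have "\<dots> = (\<Sum>R\<in>Pow S. s R * (val R \<omega> - prev R))"
      using finS by (intro sum.mono_neutral_left) (auto simp: prev1_def)
    finally show ?thesis
      by (simp add: right_diff_distrib sum_subtractf)
  qed
  obtain \<omega> where "\<omega> \<in> (\<Union>R\<in>?J. snd (conj_cond E H x R))"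
    and "gain ?J (conj_cond E H x) x s \<omega> \<le> 0"
  proof (rule coherent_prevision_gain_le_0[OF coherent, of ?J s])
    show "finite (range (fst (conj_cond E H x R)))" if "R \<in> ?J" for R
      using that finS by (intro finite_range_conj_cond) (auto intro: finite_subset)
    show "(\<Union>R\<in>?J. snd (conj_cond E H x R)) \<noteq> {}"
      unfolding U using S conditioning_nonempty by blast
  qed (use S finS in auto)
  then show ?thesis
    using le[of \<omega>] unfolding U gain by linarith
qed

lemma void_psubset:
  assumes "\<omega> \<in> (\<Union>i\<in>S. H i)"
  shows "{i \<in> S. \<omega> \<notin> H i} \<subset> S"
  using assms by auto

lemma prev_nonneg:
  assumes "S \<subseteq> N"
  shows "0 \<le> prev S"
proof -
  have "finite S"
    using assms finite_index finite_subset by blast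
  then show ?thesis
    using assms
  proof (induction S rule: finite_psubset_induct)
    case (psubset S)
    show ?case
    proof (cases "S = {}")
      case False
      let ?s = "\<lambda>R. of_bool (R = S) :: real"
      have *: "(\<Sum>R\<in>Pow S. ?s R * f R) = f S" for f :: "'i set \<Rightarrow> real"
        using psubset.hyps by (intro sum_of_bool_eq_mult) auto
      have "0 \<le> val S \<omega>" if "\<omega> \<in> (\<Union>i\<in>S. H i)" for \<omega>
        using psubset.IH[OF void_psubset[OF that]] psubset.prems
        by (auto simp: conj_value_def)
      then show ?thesis
        using prevision_ge_of_value_ge[OF False psubset.prems, of 0 ?s] unfolding * by blast
    qed (simp add: prev1_def)
  qed
qed

lemma prev_antimono:
  assumes "S \<subseteq> N" "T \<subseteq> S"
  shows "prev S \<le> prev T"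
proof -
  have "finite S"
    using assms finite_index finite_subset by blast
  then show ?thesis
    using assms
  proof (induction S arbitrary: T rule: finite_psubset_induct)
    case (psubset S)
    show ?case
    proof (cases "S = {}")
      case False
      let ?s = "\<lambda>R. of_bool (R = T) - of_bool (R = S) :: real"
      have *: "(\<Sum>R\<in>Pow S. ?s R * f R) = f T - f S" for f :: "'i set \<Rightarrow> real"
        using psubset.hyps psubset.prems
        by (simp add: left_diff_distrib sum_subtractf sum_of_bool_eq_mult)
      have "0 \<le> val T \<omega> - val S \<omega>" if \<omega>: "\<omega> \<in> (\<Union>i\<in>S. H i)" for \<omega>
      proof (cases "\<exists>i\<in>S. \<omega> \<in> H i - E i")
        case True
        moreover have "0 \<le> val T \<omega>"
          using prev_nonneg[of "{i \<in> T. \<omega> \<notin> H i}"] psubset.prems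
          by (auto simp: conj_value_def)
        ultimately show ?thesis
          by (simp add: conj_value_def)
      next
        case no_false: False
        have "prev {i \<in> S. \<omega> \<notin> H i} \<le> prev {i \<in> T. \<omega> \<notin> H i}"
          using psubset.prems by (intro psubset.IH[OF void_psubset[OF \<omega>]]) auto
        then show ?thesis
          using no_false psubset.prems(2) by (auto simp: conj_value_def)
      qed
      then show ?thesis
        using prevision_ge_of_value_ge[OF False psubset.prems(1), of 0 ?s] unfolding * by force
    qed (use psubset.prems in simp)
  qed
qed

lemma prev_le_1:
  assumes "S \<subseteq> N"
  shows "prev S \<le> 1"
  using prev_antimono[OF assms, of "{}"] by (simp add: prev1_def)

lemma val_le_1:
  assumes "S \<subseteq> N"
  shows "val S \<omega> \<le> 1"
  using prev_le_1[of "{i \<in> S. \<omega> \<notin> H i}"] assms by (auto simp: conj_value_def)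

text \<open>
  When some member is false, it makes one of the two smaller conjunctions \<open>0\<close>, and the
  other one is at most \<open>1\<close>; otherwise the inequality between the values is the induction hypothesis
  for the void members.
\<close>

lemma prev_union_ge:
  assumes "A \<union> B \<subseteq> N"
  shows "prev A + prev B - 1 \<le> prev (A \<union> B)"
proof -
  have "finite (A \<union> B)"
    using assms finite_index finite_subset by blast
  then show ?thesis
    using assms
  proof (induction "A \<union> B" arbitrary: A B rule: finite_psubset_induct)
    case (psubset A B)
    let ?S = "A \<union> B"
    show ?case
    proof (cases "?S = {}")
      case False
      let ?s = "\<lambda>R. of_bool (R = ?S) - of_bool (R = A) - of_bool (R = B) :: real"
      have *: "(\<Sum>R\<in>Pow ?S. ?s R * f R) = f ?S - f A - f B" for f :: "'i set \<Rightarrow> real"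
        using psubset.hyps(1)
        by (simp add: left_diff_distrib sum_subtractf sum_of_bool_eq_mult)
      have "- 1 \<le> val ?S \<omega> - val A \<omega> - val B \<omega>" if \<omega>: "\<omega> \<in> (\<Union>i\<in>?S. H i)" for \<omega>
      proof (cases "\<exists>i\<in>?S. \<omega> \<in> H i - E i")
        case True
        then have "val ?S \<omega> = 0" and "val A \<omega> = 0 \<or> val B \<omega> = 0"
          by (auto simp: conj_value_def)
        moreover have "val A \<omega> \<le> 1" "val B \<omega> \<le> 1"
          using psubset.prems by (simp_all add: val_le_1)
        ultimately show ?thesis
          by linarith
      next
        case no_false: False
        have un: "{i \<in> ?S. \<omega> \<notin> H i} = {i \<in> A. \<omega> \<notin> H i} \<union> {i \<in> B. \<omega> \<notin> H i}"
          by auto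
        have "prev {i \<in> A. \<omega> \<notin> H i} + prev {i \<in> B. \<omega> \<notin> H i} - 1 \<le> prev {i \<in> ?S. \<omega> \<notin> H i}"
          unfolding un
          by (rule psubset.hyps(2)) (use void_psubset[OF \<omega>] un psubset.prems in auto)
        then show ?thesis
          using no_false by (auto simp: conj_value_def)
      qed
      then show ?thesis
        using prevision_ge_of_value_ge[OF False psubset.prems, of "- 1" ?s] unfolding * by force
    qed (simp add: prev1_def)
  qed
qed

end

section \<open>Frechet bounds for the conjunction\<close>

lemma logically_independent_nonempty:
  assumes "logically_independent I A" "i \<in> I"
  shows "A i \<noteq> {}"
proof -
  have "(\<Inter>j\<in>{i}. A j) \<inter> (\<Inter>j\<in>I - {i}. - A j) \<noteq> {}"
    using assms unfolding logically_independent_def by blast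
  then show ?thesis
    by auto
qed

theorem theorem6:
  fixes E H :: "nat \<Rightarrow> 'w set" and x :: "nat set \<Rightarrow> real" and n :: nat
  assumes "n \<ge> 2"
    and "logically_independent ({1..n} <+> {1..n}) (case_sum E H)"
    and "coherent_prevision {S. S \<noteq> {} \<and> S \<subseteq> {1..n}} (conj_cond E H x) x"
  shows "\<forall>k. 1 \<le> k \<and> k \<le> n - 1 \<longrightarrow>
           max 0 (x {1..k} + x {k+1..n} - 1) \<le> x {1..n} \<and>
           x {1..n} \<le> min (x {1..k}) (x {k+1..n})"
proof (intro allI impI)
  fix k
  assume k: "1 \<le> k \<and> k \<le> n - 1"
  interpret coherent_conjunctions "{1..n}" E H x
  proof
    show "H i \<noteq> {}" if "i \<in> {1..n}" for i
      using logically_independent_nonempty[OF assms(2), of "Inr i"] that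
      by (simp add: InrI)
  qed (use assms(3) in auto)
  have un: "{1..k} \<union> {k+1..n} = {1..n}"
    using k by auto
  have "prev {1..k} = x {1..k}" "prev {k+1..n} = x {k+1..n}" "prev {1..n} = x {1..n}"
    using k assms(1) by (auto simp: prev1_def)
  then show "max 0 (x {1..k} + x {k+1..n} - 1) \<le> x {1..n} \<and>
      x {1..n} \<le> min (x {1..k}) (x {k+1..n})"
    using prev_nonneg[of "{1..n}"] prev_union_ge[of "{1..k}" "{k+1..n}"]
      prev_antimono[of "{1..n}" "{1..k}"] prev_antimono[of "{1..n}" "{k+1..n}"] un k
    by auto
qed

end
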